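(* Let $F$ be the edge-ordered star forest with five edges in which the first, third and fifth edges (in the edge order) form one star component and the second and fourth edges form another star component. Then $\mathrm{ex}_<(n,F)=\Omega(n\alpha(n))$, where $\alpha$ is the inverse Ackermann function.
   Context: Edge-ordered graph: finite simple graph with a linear order on its edges; isomorphisms preserve order; subgraphs carry induced order; $\mathrm{ex}_<(n,F)$ is the maximum number of edges of an edge-ordered graph on $n$ vertices with no subgraph isomorphic to $F$. *)

theory Defs
  imports Complex_Main "HOL-Library.Landau_Symbols"
begin

record 'a eo_graph =
  verts :: "'a set"
  edges :: "'a set set"
  eorder :: "('a set \<times> 'a set) set"

definition edge_ordered_graph :: "'a eo_graph \<Rightarrow> bool" where
  "edge_ordered_graph G \<longleftrightarrow>
     finite (verts G) \<and>
     (\<forall>e\<in>edges G. e \<subseteq> verts G \<and> card e = 2) \<and>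
     linear_order_on (edges G) (eorder G)"

definition eo_subgraph :: "'a eo_graph \<Rightarrow> 'a eo_graph \<Rightarrow> bool" where
  "eo_subgraph H G \<longleftrightarrow>
     edge_ordered_graph H \<and> edge_ordered_graph G \<and>
     verts H \<subseteq> verts G \<and> edges H \<subseteq> edges G \<and>
     eorder H = eorder G \<inter> edges H \<times> edges H"

definition eo_isomorphism :: "('a \<Rightarrow> 'b) \<Rightarrow> 'a eo_graph \<Rightarrow> 'b eo_graph \<Rightarrow> bool" where
  "eo_isomorphism f G H \<longleftrightarrow>
     bij_betw f (verts G) (verts H) \<and>
     (`) f ` edges G = edges H \<and>
     (\<forall>e\<in>edges G. \<forall>e'\<in>edges G. (e, e') \<in> eorder G \<longleftrightarrow> (f ` e, f ` e') \<in> eorder H)"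

definition eo_isomorphic :: "'a eo_graph \<Rightarrow> 'b eo_graph \<Rightarrow> bool" where
  "eo_isomorphic G H \<longleftrightarrow> (\<exists>f. eo_isomorphism f G H)"

definition eo_contains :: "'a eo_graph \<Rightarrow> 'b eo_graph \<Rightarrow> bool" where
  "eo_contains G F \<longleftrightarrow> (\<exists>H. eo_subgraph H G \<and> eo_isomorphic H F)"

text \<open>
  Taking the vertices of the host graphs in \<^typ>\<open>nat\<close> loses no generality, since every finite
  edge-ordered graph is isomorphic to one of this kind.  The set below is finite for every \<open>F\<close>, and
  nonempty as soon as \<open>F\<close> has an edge, so that \<open>Max\<close> is then a genuine maximum.
\<close>

definition ex_eo_sizes :: "nat \<Rightarrow> 'b eo_graph \<Rightarrow> nat set" where
  "ex_eo_sizes n F =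
     {card (edges G) | G :: nat eo_graph.
        edge_ordered_graph G \<and> card (verts G) = n \<and> \<not> eo_contains G F}"

definition ex_eo :: "nat \<Rightarrow> 'b eo_graph \<Rightarrow> nat" where
  "ex_eo n F = Max (ex_eo_sizes n F)"

lemma finite_ex_eo_sizes: "finite (ex_eo_sizes n F)"
proof (rule finite_subset)
  show "ex_eo_sizes n F \<subseteq> {..2 ^ n}"
  proof
    fix m assume "m \<in> ex_eo_sizes n F"
    then obtain G :: "nat eo_graph" where G: "edge_ordered_graph G" "card (verts G) = n"
      "m = card (edges G)"
      unfolding ex_eo_sizes_def by blast
    have "card (edges G) \<le> card (Pow (verts G))"
      by (rule card_mono) (use G in \<open>auto simp: edge_ordered_graph_def\<close>)
    also have "\<dots> = 2 ^ n"
      using G by (simp add: card_Pow edge_ordered_graph_def)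
    finally show "m \<in> {..2 ^ n}" using G by simp
  qed
qed simp

lemma ex_eo_sizes_nonempty:
  assumes "edges F \<noteq> {}"
  shows "ex_eo_sizes n F \<noteq> {}"
proof -
  define G :: "nat eo_graph" where "G = \<lparr>verts = {..<n}, edges = {}, eorder = {}\<rparr>"
  have "edge_ordered_graph G"
    by (auto simp: G_def edge_ordered_graph_def order_on_defs refl_on_def)
  moreover have "\<not> eo_contains G F"
    using assms
    by (auto simp: G_def eo_contains_def eo_subgraph_def eo_isomorphic_def eo_isomorphism_def)
  moreover have "card (verts G) = n" by (simp add: G_def)
  ultimately show ?thesis unfolding ex_eo_sizes_def by blast
qed

text \<open>
  The centres are \<open>0\<close> (for the first, third and fifth edge) and \<open>6\<close> (for the second and fourth
  edge); the leaf of the \<open>i\<close>-th edge is \<open>i\<close>.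
\<close>

definition F_edge :: "nat \<Rightarrow> nat set" where
  "F_edge i = {if odd i then 0 else 6, i}"

definition F_star_forest :: "nat eo_graph" where
  "F_star_forest =
     \<lparr>verts = {0..6},
      edges = F_edge ` {1..5},
      eorder = {(F_edge i, F_edge j) | i j. 1 \<le> i \<and> i \<le> j \<and> j \<le> 5}\<rparr>"

lemma F_edges_eq: "edges F_star_forest = {{0, 1}, {6, 2}, {0, 3}, {6, 4}, {0, 5}}"
proof -
  have "{1..5::nat} = {1, 2, 3, 4, 5}" by auto
  then show ?thesis by (auto simp: F_star_forest_def F_edge_def)
qed

lemma inj_on_F_edge: "inj_on F_edge {1..5}"
  by (auto simp: inj_on_def F_edge_def doubleton_eq_iff split: if_splits)

lemma edge_ordered_graph_F: "edge_ordered_graph F_star_forest"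
proof -
  have inj: "F_edge i = F_edge j \<longleftrightarrow> i = j" if "1 \<le> i" "i \<le> 5" "1 \<le> j" "j \<le> 5" for i j
    using inj_on_F_edge that by (auto simp: inj_on_def)
  let ?E = "edges F_star_forest" and ?r = "eorder F_star_forest"
  have r: "(x, y) \<in> ?r \<longleftrightarrow> (\<exists>i j. x = F_edge i \<and> y = F_edge j \<and> 1 \<le> i \<and> i \<le> j \<and> j \<le> 5)" for x y
    by (auto simp: F_star_forest_def)
  have E: "x \<in> ?E \<longleftrightarrow> (\<exists>i. x = F_edge i \<and> 1 \<le> i \<and> i \<le> 5)" for x
    by (auto simp: F_star_forest_def)
  have "?r \<subseteq> ?E \<times> ?E"
  proof clarify
    fix x y assume "(x, y) \<in> ?r"
    then obtain i j where "x = F_edge i" "y = F_edge j" "1 \<le> i" "i \<le> j" "j \<le> 5"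
      unfolding r by blast
    moreover from this have "i \<le> 5" "1 \<le> j" by simp_all
    ultimately show "x \<in> ?E \<and> y \<in> ?E" unfolding E by blast
  qed
  moreover have "refl_on ?E ?r"
    unfolding refl_on_def Ball_def r E by blast
  moreover have "trans ?r"
  proof (rule transI)
    fix x y z assume "(x, y) \<in> ?r" "(y, z) \<in> ?r"
    then obtain i j k l where *: "x = F_edge i" "y = F_edge j" "1 \<le> i" "i \<le> j" "j \<le> 5"
      "y = F_edge k" "z = F_edge l" "1 \<le> k" "k \<le> l" "l \<le> 5" unfolding r by blast
    have "j = k" using inj[of j k] * by simp
    with * have "i \<le> l" by simp
    with * show "(x, z) \<in> ?r" unfolding r by blast
  qed
  moreover have "antisym ?r"
  proof (rule antisymI)
    fix x y assume "(x, y) \<in> ?r" "(y, x) \<in> ?r"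
    then obtain i j k l where *: "x = F_edge i" "y = F_edge j" "1 \<le> i" "i \<le> j" "j \<le> 5"
      "y = F_edge k" "x = F_edge l" "1 \<le> k" "k \<le> l" "l \<le> 5" unfolding r by blast
    moreover have "j = k" "i = l" using inj[of j k] inj[of i l] * by simp_all
    ultimately show "x = y" by simp
  qed
  moreover have "total_on ?E ?r"
    unfolding total_on_def Ball_def r E by (metis nle_le)
  moreover have "\<forall>e\<in>?E. e \<subseteq> verts F_star_forest \<and> card e = 2"
    unfolding F_edges_eq by (auto simp: F_star_forest_def)
  ultimately show ?thesis
    by (simp add: edge_ordered_graph_def order_on_defs F_star_forest_def)
qed

text \<open>
  The two-variable Ackermann--Peter function and the inverse of its diagonal.
  Other usual versions of the inverse Ackermann function differ from this one by a bounded amount.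
\<close>

fun ack :: "nat \<Rightarrow> nat \<Rightarrow> nat" where
  "ack 0 n = Suc n"
| "ack (Suc m) 0 = ack m 1"
| "ack (Suc m) (Suc n) = ack m (ack (Suc m) n)"

definition inv_ack :: "nat \<Rightarrow> nat" where
  "inv_ack n = (LEAST k. n \<le> ack k k)"

lemma less_ack: "n < ack m n"
  by (induction m n rule: ack.induct) auto

lemma inv_ack_le: "n \<le> ack (inv_ack n) (inv_ack n)"
  unfolding inv_ack_def by (rule LeastI[of _ n]) (simp add: less_ack less_imp_le)

end

theory Submission
  imports Defs
begin

text \<open>
  Consider the incidence graph between symbols and linearly ordered blocks, with the edges ordered
  by their blocks. It contains the star forest only if two symbols \<open>a\<close>, \<open>b\<close> occur in the pattern
  \<open>a b a b a\<close> in five distinct blocks. Systems avoiding this pattern, in which every symbol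
  occurs \<open>k\<close> times and the number of blocks is linear in the number of symbols, are constructed by
  a double recursion of Hart--Sharir type. Their size is bounded by the Ackermann function at
  level \<open>2 k\<close>, so that \<open>k\<close> can be taken proportional to \<open>\<alpha>(n)\<close>; disjoint copies of the system
  fill up the remaining vertices.
\<close>

section \<open>Alternation\<close>

definition alternates :: "nat set \<Rightarrow> nat set \<Rightarrow> bool" where
  "alternates A B \<longleftrightarrow>
     (\<exists>x\<^sub>1\<in>A. \<exists>x\<^sub>2\<in>B. \<exists>x\<^sub>3\<in>A. \<exists>x\<^sub>4\<in>B. \<exists>x\<^sub>5\<in>A. x\<^sub>1 < x\<^sub>2 \<and> x\<^sub>2 < x\<^sub>3 \<and> x\<^sub>3 < x\<^sub>4 \<and> x\<^sub>4 < x\<^sub>5)"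

lemma alternatesI:
  "\<lbrakk>x\<^sub>1 \<in> A; x\<^sub>2 \<in> B; x\<^sub>3 \<in> A; x\<^sub>4 \<in> B; x\<^sub>5 \<in> A; x\<^sub>1 < x\<^sub>2; x\<^sub>2 < x\<^sub>3; x\<^sub>3 < x\<^sub>4; x\<^sub>4 < x\<^sub>5\<rbrakk>
    \<Longrightarrow> alternates A B"
  unfolding alternates_def by blast

lemma alternatesE:
  assumes "alternates A B"
  obtains x\<^sub>1 x\<^sub>2 x\<^sub>3 x\<^sub>4 x\<^sub>5 where "x\<^sub>1 \<in> A" "x\<^sub>2 \<in> B" "x\<^sub>3 \<in> A" "x\<^sub>4 \<in> B" "x\<^sub>5 \<in> A"
    "x\<^sub>1 < x\<^sub>2" "x\<^sub>2 < x\<^sub>3" "x\<^sub>3 < x\<^sub>4" "x\<^sub>4 < x\<^sub>5"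
  using assms unfolding alternates_def by blast

text \<open>For \<open>q \<le> w\<close>, comparing the codes \<open>pos w p q\<close> is comparing the pairs \<open>(p, q)\<close> lexicographically.\<close>

definition pos :: "nat \<Rightarrow> nat \<Rightarrow> nat \<Rightarrow> nat" where
  "pos w p q = p * Suc w + q"

lemma pos_less_iff:
  assumes "q \<le> w" "q' \<le> w"
  shows "pos w p q < pos w p' q' \<longleftrightarrow> p < p' \<or> p = p' \<and> q < q'"
proof -
  have *: "pos w a b < pos w c d" if "a < c" "b \<le> w" for a b c d
  proof -
    have "Suc a * Suc w \<le> c * Suc w" using that by (intro mult_le_mono1) simp
    then show ?thesis using that by (simp add: pos_def)
  qed
  show ?thesis
    using *[of p p' q q'] *[of p' p q' q] assms
    by (cases p p' rule: linorder_cases) (auto simp: pos_def)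
qed

lemma pos_eq_iff:
  assumes "q \<le> w" "q' \<le> w"
  shows "pos w p q = pos w p' q' \<longleftrightarrow> p = p' \<and> q = q'"
  using pos_less_iff[OF assms, of p p'] pos_less_iff[OF assms(2,1), of p' p]
  by (metis less_irrefl linorder_neqE_nat)

lemma pos_le_iff:
  assumes "q \<le> w" "q' \<le> w"
  shows "pos w p q \<le> pos w p' q' \<longleftrightarrow> p < p' \<or> p = p' \<and> q \<le> q'"
  using pos_less_iff[OF assms, of p p'] pos_eq_iff[OF assms, of p p']
  by (auto simp: le_less)

lemma pos_div [simp]: "q \<le> w \<Longrightarrow> pos w p q div Suc w = p"
  unfolding pos_def by (simp only: div_mult_self3[OF nat.simps(3)] div_less less_Suc_eq_le add_0_right)

lemma pos_mod [simp]: "q \<le> w \<Longrightarrow> pos w p q mod Suc w = q"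
  unfolding pos_def by (simp only: mod_mult_self3 mod_less less_Suc_eq_le)

lemma finite_nat_subset_lessThan:
  fixes A :: "nat set"
  shows "finite A \<Longrightarrow> \<exists>w. A \<subseteq> {..<w}"
  by (auto simp: finite_nat_set_iff_bounded)

lemma inj_on_pos: "A \<subseteq> {..w} \<Longrightarrow> inj_on (pos w p) A"
  by (auto simp: inj_on_def pos_eq_iff subset_iff)

lemma inj_on_pos_pair: "B \<subseteq> {..w} \<Longrightarrow> inj_on (\<lambda>(p, q). pos w p q) (A \<times> B)"
  by (auto simp: inj_on_def pos_eq_iff subset_iff)

text \<open>The codes with a given first coordinate form an interval. The pattern puts an element of
  each set between two elements of the other, so the first coordinates agree and only the second
  ones matter.\<close>

lemma alternates_posD:
  assumes "alternates (pos w p ` A) (pos w p' ` B)" "A \<subseteq> {..w}" "B \<subseteq> {..w}"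
  shows "p = p' \<and> alternates A B"
proof -
  from assms(1) obtain a\<^sub>1 b\<^sub>1 a\<^sub>2 b\<^sub>2 a\<^sub>3 where
    mem: "a\<^sub>1 \<in> A" "b\<^sub>1 \<in> B" "a\<^sub>2 \<in> A" "b\<^sub>2 \<in> B" "a\<^sub>3 \<in> A" and
    less: "pos w p a\<^sub>1 < pos w p' b\<^sub>1" "pos w p' b\<^sub>1 < pos w p a\<^sub>2"
      "pos w p a\<^sub>2 < pos w p' b\<^sub>2" "pos w p' b\<^sub>2 < pos w p a\<^sub>3"
    unfolding alternates_def by blast
  have le: "a\<^sub>1 \<le> w" "b\<^sub>1 \<le> w" "a\<^sub>2 \<le> w" "b\<^sub>2 \<le> w" "a\<^sub>3 \<le> w" using mem assms(2,3) by auto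
  have "p = p'" "a\<^sub>1 < b\<^sub>1" "b\<^sub>1 < a\<^sub>2" "a\<^sub>2 < b\<^sub>2" "b\<^sub>2 < a\<^sub>3"
    using less by (auto simp: pos_less_iff le)
  then show ?thesis using mem by (blast intro: alternatesI)
qed

section \<open>Fan systems\<close>

text \<open>
  The symbols are the pairs \<open>(p, r)\<close> with \<open>p \<in> P\<close> and \<open>r \<in> M\<close>, and \<open>I p r\<close> is the set of blocks
  containing the symbol. The fans are the blocks in \<open>P\<close>: the fan \<open>p\<close> consists of
  the first occurrences of the symbols \<open>(p, r)\<close>. The rank set \<open>M\<close> is arbitrary so that it can be
  instantiated with the set of fans of another system.
\<close>

locale fan_system =
  fixes k :: nat and M P Q :: "nat set" and I :: "nat \<Rightarrow> nat \<Rightarrow> nat set"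
  assumes finite_blocks: "finite Q"
    and fans_subset: "P \<subseteq> Q"
    and occ_subset: "\<lbrakk>p \<in> P; r \<in> M\<rbrakk> \<Longrightarrow> I p r \<subseteq> Q"
    and card_occ: "\<lbrakk>p \<in> P; r \<in> M\<rbrakk> \<Longrightarrow> card (I p r) = k"
    and fan_in_occ: "\<lbrakk>p \<in> P; r \<in> M\<rbrakk> \<Longrightarrow> p \<in> I p r"
    and fan_le_occ: "\<lbrakk>p \<in> P; r \<in> M; x \<in> I p r\<rbrakk> \<Longrightarrow> p \<le> x"
    and fan_unique: "\<lbrakk>p \<in> P; r \<in> M; x \<in> I p r; x \<in> P\<rbrakk> \<Longrightarrow> x = p"
    and separated: "\<lbrakk>p \<in> P; r \<in> M; s \<in> M; r < s; x \<in> I p r; y \<in> I p s; p < x; p < y\<rbrakk> \<Longrightarrow> x \<le> y"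
    and not_alternates: "\<lbrakk>p \<in> P; r \<in> M; p' \<in> P; r' \<in> M; (p, r) \<noteq> (p', r')\<rbrakk>
      \<Longrightarrow> \<not> alternates (I p r) (I p' r')"

text \<open>Two fans rather than one, so that \<open>card Q + 2 \<le> 2 * card P\<close> holds, with
  equality, at the start of the induction. The same two blocks serve below for an empty rank
  set.\<close>

lemma fan_system_singletons:
  "fan_system 1 M {0, 1} {0, 1} (\<lambda>p r. {p})"
  by unfold_locales (auto simp: alternates_def)

lemma fan_system_no_symbols:
  "fan_system k {} {0, 1} {0, 1} I"
  by unfold_locales auto

text \<open>
  Every fan \<open>p\<close> of the outer system is replaced by a copy of the inner system followed by the
  block \<open>p\<close> itself; the symbol of rank \<open>q\<close> in the fan \<open>p\<close> is in addition inserted, with the new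
  largest rank \<open>z\<close>, into the fan \<open>q\<close> of the copy.
\<close>

locale fan_composition =
  inner: fan_system "Suc k" M P\<^sub>1 Q\<^sub>1 I\<^sub>1 + outer: fan_system k P\<^sub>1 P\<^sub>2 Q\<^sub>2 I\<^sub>2
  for k M P\<^sub>1 Q\<^sub>1 I\<^sub>1 P\<^sub>2 Q\<^sub>2 I\<^sub>2 +
  fixes w z :: nat
  assumes inner_bound: "Q\<^sub>1 \<subseteq> {..<w}"
    and ranks_less: "r \<in> M \<Longrightarrow> r < z"
begin

definition fans :: "nat set" where
  "fans = (\<lambda>(p, q). pos w p q) ` (P\<^sub>2 \<times> P\<^sub>1)"

text \<open>Inner blocks lie below \<open>w\<close>, so the reserved second coordinate
  \<open>w\<close> puts the outer block \<open>p\<close> right after the copy at \<open>p\<close>.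
  Outer blocks that are not fans come without a copy.\<close>

definition blocks :: "nat set" where
  "blocks = (\<lambda>(p, q). pos w p q) ` (P\<^sub>2 \<times> Q\<^sub>1) \<union> (\<lambda>p. pos w p w) ` Q\<^sub>2"

definition new_occ :: "nat \<Rightarrow> nat \<Rightarrow> nat set" where
  "new_occ p q = insert (pos w p q) ((\<lambda>x. pos w x w) ` I\<^sub>2 p q)"

text \<open>A fan of the composite is a single number, so its copy \<open>p\<close> and its inner
  fan \<open>q\<close> are recovered by division.\<close>

definition occ :: "nat \<Rightarrow> nat \<Rightarrow> nat set" where
  "occ x r = (let p = x div Suc w; q = x mod Suc w in
     if r = z then new_occ p q else pos w p ` I\<^sub>1 q r)"

section \<open>Positions of old and new symbols in the composite\<close>

lemma inner_fan_less: "q \<in> P\<^sub>1 \<Longrightarrow> q < w"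
  using inner.fans_subset inner_bound by auto

lemma inner_occ_less: "\<lbrakk>q \<in> P\<^sub>1; r \<in> M; x \<in> I\<^sub>1 q r\<rbrakk> \<Longrightarrow> x < w"
  using inner.occ_subset inner_bound by blast

lemma occ_old: "\<lbrakk>q \<in> P\<^sub>1; r \<in> M\<rbrakk> \<Longrightarrow> occ (pos w p q) r = pos w p ` I\<^sub>1 q r"
  using inner_fan_less[of q] ranks_less[of r] by (simp add: occ_def)

lemma occ_new: "q \<in> P\<^sub>1 \<Longrightarrow> occ (pos w p q) z = new_occ p q"
  using inner_fan_less[of q] by (simp add: occ_def)

lemma new_occ_cases:
  assumes "x \<in> new_occ p q" "p \<in> P\<^sub>2" "q \<in> P\<^sub>1"
  obtains "x = pos w p q" | u where "x = pos w u w" "u \<in> I\<^sub>2 p q" "p \<le> u"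
  using assms outer.fan_le_occ unfolding new_occ_def by blast

lemma new_occ_ge:
  assumes "x \<in> new_occ p q" "p \<in> P\<^sub>2" "q \<in> P\<^sub>1"
  shows "pos w p q \<le> x"
  using assms by (rule new_occ_cases) (use inner_fan_less[of q] assms in \<open>auto simp: pos_le_iff\<close>)

lemma new_occ_greater:
  assumes "x \<in> new_occ p q" "p \<in> P\<^sub>2" "q \<in> P\<^sub>1" "pos w p q < x"
  obtains u where "x = pos w u w" "u \<in> I\<^sub>2 p q" "p \<le> u"
  using assms(1-3) by (rule new_occ_cases) (use assms(4) in \<open>auto intro: that\<close>)

text \<open>No outer block lies between two inner blocks of the same copy, so a new symbol can occur
  there only at its fan.\<close>

lemma new_occ_below:
  assumes "x \<in> new_occ p q" "p \<in> P\<^sub>2" "q \<in> P\<^sub>1"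
    and "pos w p' a \<le> x" "x \<le> pos w p' b" "a < w" "b < w"
  shows "x = pos w p q"
  using assms(1-3) by (rule new_occ_cases) (use assms(4-) in \<open>auto simp: pos_le_iff\<close>)

text \<open>Both occurrences of the new symbol would lie between inner blocks of the copy
  \<open>p\<close>, hence both would be its fan.\<close>

lemma not_alternates_old_new:
  assumes "p \<in> P\<^sub>2" "q \<in> P\<^sub>1" "r \<in> M" "p' \<in> P\<^sub>2" "q' \<in> P\<^sub>1"
  shows "\<not> alternates (pos w p ` I\<^sub>1 q r) (new_occ p' q')"
proof
  assume "alternates (pos w p ` I\<^sub>1 q r) (new_occ p' q')"
  then obtain a b c x y where *: "a \<in> I\<^sub>1 q r" "b \<in> I\<^sub>1 q r" "c \<in> I\<^sub>1 q r"
    "x \<in> new_occ p' q'" "y \<in> new_occ p' q'"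
    "pos w p a < x" "x < pos w p b" "pos w p b < y" "y < pos w p c"
    unfolding alternates_def by blast
  have less: "a < w" "b < w" "c < w" using * inner_occ_less assms by blast+
  have "x = pos w p' q'" "y = pos w p' q'"
    using new_occ_below[of x p' q' p a b] new_occ_below[of y p' q' p b c] * assms less by simp_all
  then show False using * by simp
qed

text \<open>The middle occurrence of the new symbol would lie between inner blocks of one copy and
  so be its fan. That is its first occurrence, yet another one precedes it.\<close>

lemma not_alternates_new_old:
  assumes "p \<in> P\<^sub>2" "q \<in> P\<^sub>1" "r \<in> M" "p' \<in> P\<^sub>2" "q' \<in> P\<^sub>1"
  shows "\<not> alternates (new_occ p' q') (pos w p ` I\<^sub>1 q r)"
proof
  assume "alternates (new_occ p' q') (pos w p ` I\<^sub>1 q r)"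
  then obtain a b x y where *: "a \<in> I\<^sub>1 q r" "b \<in> I\<^sub>1 q r"
    "x \<in> new_occ p' q'" "y \<in> new_occ p' q'"
    "x < pos w p a" "pos w p a < y" "y < pos w p b"
    unfolding alternates_def by blast
  have less: "a < w" "b < w" using * inner_occ_less assms by blast+
  have "y = pos w p' q'"
    using new_occ_below[of y p' q' p a b] * assms less by simp
  moreover have "pos w p' q' \<le> x" using new_occ_ge * assms by blast
  ultimately show False using * by simp
qed

text \<open>After their fans both symbols occur only in outer blocks, where the separation of ranks
  in the outer system limits how they interleave.\<close>

lemma not_alternates_new_same_fan:
  assumes "p \<in> P\<^sub>2" "q \<in> P\<^sub>1" "q' \<in> P\<^sub>1" "q \<noteq> q'"
  shows "\<not> alternates (new_occ p q) (new_occ p q')"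
proof
  assume "alternates (new_occ p q) (new_occ p q')"
  then obtain x\<^sub>1 x\<^sub>2 x\<^sub>3 x\<^sub>4 x\<^sub>5 where x: "x\<^sub>1 \<in> new_occ p q" "x\<^sub>2 \<in> new_occ p q'"
    "x\<^sub>3 \<in> new_occ p q" "x\<^sub>4 \<in> new_occ p q'" "x\<^sub>5 \<in> new_occ p q"
    "x\<^sub>1 < x\<^sub>2" "x\<^sub>2 < x\<^sub>3" "x\<^sub>3 < x\<^sub>4" "x\<^sub>4 < x\<^sub>5"
    by (rule alternatesE)
  have ge: "pos w p q \<le> x\<^sub>1" "pos w p q' \<le> x\<^sub>2" using new_occ_ge x assms by blast+
  obtain u\<^sub>3 where u3: "x\<^sub>3 = pos w u\<^sub>3 w" "u\<^sub>3 \<in> I\<^sub>2 p q" "p \<le> u\<^sub>3"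
    by (rule new_occ_greater[of x\<^sub>3 p q]) (use x ge assms in auto)
  obtain u\<^sub>4 where u4: "x\<^sub>4 = pos w u\<^sub>4 w" "u\<^sub>4 \<in> I\<^sub>2 p q'" "p \<le> u\<^sub>4"
    by (rule new_occ_greater[of x\<^sub>4 p q']) (use x ge assms in auto)
  obtain u\<^sub>5 where u5: "x\<^sub>5 = pos w u\<^sub>5 w" "u\<^sub>5 \<in> I\<^sub>2 p q" "p \<le> u\<^sub>5"
    by (rule new_occ_greater[of x\<^sub>5 p q]) (use x ge assms in auto)
  have u: "u\<^sub>3 < u\<^sub>4" "u\<^sub>4 < u\<^sub>5" using x u3 u4 u5 by (auto simp: pos_less_iff)
  show False
  proof (cases "q < q'")
    case True
    then have "u\<^sub>5 \<le> u\<^sub>4"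
      using outer.separated[of p q q' u\<^sub>5 u\<^sub>4] assms u u3 u4 u5 by simp
    then show False using u by simp
  next
    case False
    then have "q' < q" using assms by simp
    then have "pos w p q' < pos w p q"
      using inner_fan_less assms by (auto simp: pos_def)
    \<comment> \<open>Already \<open>x\<^sub>1\<close> is past the fan of the smaller rank
      \<open>q'\<close>, so \<open>x\<^sub>2\<close> is an outer block. This pushes
      \<open>u\<^sub>3\<close> and \<open>u\<^sub>4\<close> strictly beyond \<open>p\<close>, where
      separation applies.\<close>
    then obtain u\<^sub>2 where u2: "x\<^sub>2 = pos w u\<^sub>2 w" "p \<le> u\<^sub>2"
      by (rule_tac new_occ_greater[of x\<^sub>2 p q']) (use x ge assms in auto)
    then have "p < u\<^sub>3" using x u3 by (auto simp: pos_less_iff)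
    then have "u\<^sub>4 \<le> u\<^sub>3"
      using outer.separated[of p q' q u\<^sub>4 u\<^sub>3] assms u u3 u4 \<open>q' < q\<close> by simp
    then show False using u by simp
  qed
qed

lemma new_occ_div:
  assumes "x \<in> new_occ p q" "p \<in> P\<^sub>2" "q \<in> P\<^sub>1"
  shows "x div Suc w \<in> I\<^sub>2 p q"
  using assms(1-3) by (rule new_occ_cases)
    (use assms outer.fan_in_occ inner_fan_less[of q] in auto)

text \<open>Collapsing each copy onto its outer block could merge two such positions only if one
  symbol occurred in the outer fan of the other, which \<open>fan_unique\<close> excludes. Hence an
  alternation descends to the outer system.\<close>

lemma new_occ_div_less:
  assumes "x \<in> new_occ p q" "p \<in> P\<^sub>2" "q \<in> P\<^sub>1" "y \<in> new_occ p' q'" "p' \<in> P\<^sub>2" "q' \<in> P\<^sub>1"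
    and "p \<noteq> p'" "x < y"
  shows "x div Suc w < y div Suc w"
proof -
  have ne: "p \<notin> I\<^sub>2 p' q'" "p' \<notin> I\<^sub>2 p q"
    using outer.fan_unique assms by blast+
  have q: "q < w" "q' < w" using inner_fan_less assms by auto
  from assms(1-3) show ?thesis
  proof (rule new_occ_cases)
    assume x: "x = pos w p q"
    from assms(4-6) show ?thesis
      by (rule new_occ_cases) (use x q assms(7,8) ne in \<open>auto simp: pos_less_iff\<close>)
  next
    fix u assume x: "x = pos w u w" "u \<in> I\<^sub>2 p q"
    from assms(4-6) show ?thesis
      by (rule new_occ_cases) (use x q assms(7,8) ne in \<open>auto simp: pos_less_iff\<close>)
  qed
qed

lemma not_alternates_new:
  assumes "p \<in> P\<^sub>2" "q \<in> P\<^sub>1" "p' \<in> P\<^sub>2" "q' \<in> P\<^sub>1" "(p, q) \<noteq> (p', q')"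
  shows "\<not> alternates (new_occ p q) (new_occ p' q')"
proof (cases "p = p'")
  case True
  then show ?thesis using not_alternates_new_same_fan assms by blast
next
  case False
  show ?thesis
  proof
    assume "alternates (new_occ p q) (new_occ p' q')"
    then obtain x\<^sub>1 x\<^sub>2 x\<^sub>3 x\<^sub>4 x\<^sub>5 where x: "x\<^sub>1 \<in> new_occ p q" "x\<^sub>2 \<in> new_occ p' q'"
      "x\<^sub>3 \<in> new_occ p q" "x\<^sub>4 \<in> new_occ p' q'" "x\<^sub>5 \<in> new_occ p q"
      "x\<^sub>1 < x\<^sub>2" "x\<^sub>2 < x\<^sub>3" "x\<^sub>3 < x\<^sub>4" "x\<^sub>4 < x\<^sub>5"
      by (rule alternatesE)
    note less = new_occ_div_less[of _ p q _ p' q'] new_occ_div_less[of _ p' q' _ p q]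
    have "alternates (I\<^sub>2 p q) (I\<^sub>2 p' q')"
      using x assms False
      by (intro alternatesI[of "x\<^sub>1 div Suc w" _ "x\<^sub>2 div Suc w" _ "x\<^sub>3 div Suc w" "x\<^sub>4 div Suc w"
            "x\<^sub>5 div Suc w"] new_occ_div less) simp_all
    then show False using outer.not_alternates assms by blast
  qed
qed

section \<open>The composite as a fan system, and its size\<close>

lemma finite_outer_occ: "\<lbrakk>p \<in> P\<^sub>2; q \<in> P\<^sub>1\<rbrakk> \<Longrightarrow> finite (I\<^sub>2 p q)"
  using outer.occ_subset outer.finite_blocks finite_subset by blast

lemma card_new_occ:
  assumes "p \<in> P\<^sub>2" "q \<in> P\<^sub>1"
  shows "card (new_occ p q) = Suc k"
proof -
  have "pos w p q \<notin> (\<lambda>x. pos w x w) ` I\<^sub>2 p q"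
    using inner_fan_less[of q] assms by (auto simp: pos_eq_iff)
  moreover have "inj_on (\<lambda>x. pos w x w) (I\<^sub>2 p q)" by (auto simp: inj_on_def pos_eq_iff)
  ultimately show ?thesis
    using finite_outer_occ[OF assms] outer.card_occ[OF assms]
    by (simp add: new_occ_def card_image)
qed

lemma fansE:
  assumes "x \<in> fans"
  obtains p q where "x = pos w p q" "p \<in> P\<^sub>2" "q \<in> P\<^sub>1" "q < w"
  using assms inner_fan_less unfolding fans_def by auto

lemma occ_cases:
  assumes "x \<in> fans" "r \<in> insert z M"
  obtains (old) p q where "x = pos w p q" "p \<in> P\<^sub>2" "q \<in> P\<^sub>1" "q < w" "r \<in> M" "r < z"
      "occ x r = pos w p ` I\<^sub>1 q r"
    | (new) p q where "x = pos w p q" "p \<in> P\<^sub>2" "q \<in> P\<^sub>1" "q < w" "r = z"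
      "occ x r = new_occ p q"
  using assms(1)
proof (rule fansE)
  fix p q assume x: "x = pos w p q" "p \<in> P\<^sub>2" "q \<in> P\<^sub>1" "q < w"
  show thesis
  proof (cases "r = z")
    case True
    with x show thesis using new[of p q] by (simp add: occ_new)
  next
    case False
    with x show thesis using old[of p q] assms(2) ranks_less[of r] by (simp add: occ_old)
  qed
qed

sublocale composite: fan_system "Suc k" "insert z M" fans blocks occ
proof unfold_locales
  show "finite blocks"
    unfolding blocks_def using inner.finite_blocks outer.finite_blocks outer.fans_subset
    by (auto intro: finite_subset)
  show "fans \<subseteq> blocks"
    unfolding fans_def blocks_def using inner.fans_subset by fast
next
  fix x r assume xr: "x \<in> fans" "r \<in> insert z M"
  then show "occ x r \<subseteq> blocks"
  proof (cases rule: occ_cases)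
    case (old p q)
    then show ?thesis using inner.occ_subset[of q r] by (auto simp: blocks_def)
  next
    case (new p q)
    then show ?thesis using outer.occ_subset[of p q] inner.fans_subset
      by (auto simp: blocks_def new_occ_def)
  qed
  from xr show "card (occ x r) = Suc k"
  proof (cases rule: occ_cases)
    case (old p q)
    have "I\<^sub>1 q r \<subseteq> {..w}" using old inner_occ_less by (auto intro: less_imp_le)
    then show ?thesis using old inner.card_occ by (simp add: card_image inj_on_pos)
  next
    case (new p q)
    then show ?thesis by (simp add: card_new_occ)
  qed
  from xr show "x \<in> occ x r"
  proof (cases rule: occ_cases)
    case (old p q)
    then show ?thesis using inner.fan_in_occ by simp
  next
    case (new p q)
    then show ?thesis by (simp add: new_occ_def)
  qed
next
  fix x r y assume xr: "x \<in> fans" "r \<in> insert z M" and y: "y \<in> occ x r"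
  from xr show "x \<le> y"
  proof (cases rule: occ_cases)
    case (old p q)
    then show ?thesis using y inner.fan_le_occ by (auto simp: pos_def)
  next
    case (new p q)
    then show ?thesis using y new_occ_ge by simp
  qed
  assume "y \<in> fans"
  then obtain p' q' where y': "y = pos w p' q'" "q' \<in> P\<^sub>1" "q' < w" by (rule fansE)
  from xr show "y = x"
  proof (cases rule: occ_cases)
    case (old p q)
    with y obtain v where "y = pos w p v" "v \<in> I\<^sub>1 q r" by auto
    moreover from this have "v < w" using inner_occ_less old by blast
    ultimately show ?thesis using y' old inner.fan_unique[of q r v] by (auto simp: pos_eq_iff)
  next
    case (new p q)
    then show ?thesis using y y' by (auto simp: new_occ_def pos_eq_iff)
  qed
next
  fix x r s a b
  assume xr: "x \<in> fans" "r \<in> insert z M" and s: "s \<in> insert z M" "r < s"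
    and ab: "a \<in> occ x r" "b \<in> occ x s" "x < a" "x < b"
  from xr show "a \<le> b"
  proof (cases rule: occ_cases)
    case (old p q)
    with ab obtain u where u: "a = pos w p u" "u \<in> I\<^sub>1 q r" by auto
    then have uw: "u < w" using inner_occ_less old by blast
    have qu: "q < u" using ab old u uw by (simp add: pos_less_iff)
    show ?thesis
    proof (cases "s = z")
      case True
      then have "b \<in> new_occ p q" using ab old by (simp add: occ_new)
      \<comment> \<open>After its fan, the symbol of rank \<open>z\<close> occurs only in outer
        blocks, the first possible one being the end of the copy \<open>p\<close>. These lie beyond
        every old occurrence in that copy.\<close>
      then obtain v where "b = pos w v w" "p \<le> v"
        by (rule new_occ_greater) (use old ab in auto)
      then show ?thesis using u uw by (auto simp: pos_le_iff)
    next
      case False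
      with s ab old obtain v where v: "b = pos w p v" "v \<in> I\<^sub>1 q s" by (auto simp: occ_old)
      then have "v < w" using inner_occ_less old s False by blast
      then have "q < v" using ab old v by (simp add: pos_less_iff)
      then have "u \<le> v"
        using inner.separated[of q r s u v] old s False u v qu by simp
      then show ?thesis using u v by (simp add: pos_def)
    qed
  next
    case (new p q)
    \<comment> \<open>Vacuous: no rank \<open>s\<close> exceeds the largest rank
      \<open>z\<close>.\<close>
    then show ?thesis using s ranks_less by force
  qed
next
  fix x r x' r'
  assume xr: "x \<in> fans" "r \<in> insert z M" and xr': "x' \<in> fans" "r' \<in> insert z M"
    and ne: "(x, r) \<noteq> (x', r')"
  from xr show "\<not> alternates (occ x r) (occ x' r')"
  proof (cases rule: occ_cases)
    case (old p q)
    note old1 = this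
    from xr' show ?thesis
    proof (cases rule: occ_cases)
      case (old p' q')
      have "I\<^sub>1 q r \<subseteq> {..w}" "I\<^sub>1 q' r' \<subseteq> {..w}"
        using old old1 inner_occ_less by (auto intro: less_imp_le)
      then show ?thesis
        using alternates_posD[of w p "I\<^sub>1 q r" p' "I\<^sub>1 q' r'"] old old1 ne
          inner.not_alternates[of q r q' r'] by auto
    next
      case (new p' q')
      then show ?thesis using old1 not_alternates_old_new by simp
    qed
  next
    case (new p q)
    note new1 = this
    from xr' show ?thesis
    proof (cases rule: occ_cases)
      case (old p' q')
      then show ?thesis using new1 not_alternates_new_old by simp
    next
      case (new p' q')
      then show ?thesis using new1 ne not_alternates_new[of p q p' q'] by auto
    qed
  qed
qed

lemma card_fans: "card fans = card P\<^sub>2 * card P\<^sub>1"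
proof -
  have "P\<^sub>1 \<subseteq> {..w}" using inner_fan_less by (auto intro: less_imp_le)
  then show ?thesis
    unfolding fans_def by (simp add: card_image inj_on_pos_pair card_cartesian_product)
qed

lemma card_blocks: "card blocks \<le> card P\<^sub>2 * card Q\<^sub>1 + card Q\<^sub>2"
proof -
  have "finite P\<^sub>2" using outer.fans_subset outer.finite_blocks by (rule finite_subset)
  then have "card ((\<lambda>(p, q). pos w p q) ` (P\<^sub>2 \<times> Q\<^sub>1)) \<le> card P\<^sub>2 * card Q\<^sub>1"
    using card_image_le[of "P\<^sub>2 \<times> Q\<^sub>1" "\<lambda>(p, q). pos w p q"] inner.finite_blocks
    by (simp add: card_cartesian_product)
  moreover have "card ((\<lambda>p. pos w p w) ` Q\<^sub>2) \<le> card Q\<^sub>2"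
    using outer.finite_blocks by (rule card_image_le)
  ultimately show ?thesis
    unfolding blocks_def by (meson add_mono card_Un_le le_trans)
qed

end

section \<open>The double recursion on occurrences and ranks\<close>

fun num_fans :: "nat \<Rightarrow> nat \<Rightarrow> nat" where
  "num_fans 0 m = 2"
| "num_fans (Suc k) 0 = 2"
| "num_fans (Suc k) (Suc m) = num_fans (Suc k) m * num_fans k (num_fans (Suc k) m)"

text \<open>The induction on \<open>k\<close> is for all rank sets; inside it, \<open>M\<close>
  grows by a new largest element. The index of \<open>num_fans\<close> is one less than the number
  of occurrences. The summand 2 strengthens a linear bound on the blocks so that it survives
  composition.\<close>

lemma ex_fan_system:
  assumes "finite M"
  shows "\<exists>P Q I. fan_system (Suc k) M P Q I \<and> card P = num_fans k (card M) \<and>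
    card Q + 2 \<le> 2 * card P"
  using assms
proof (induction k arbitrary: M)
  case 0
  have "card {0, 1::nat} = 2" by simp
  then show ?case
    using fan_system_singletons[of M] by (intro exI[of _ "{0, 1}"] exI) auto
next
  case (Suc k)
  note outer_IH = Suc.IH
  from Suc.prems show ?case
  proof (induction M rule: finite_linorder_max_induct)
    case empty
    have "card {0, 1::nat} = 2" by simp
    then show ?case
      using fan_system_no_symbols[of "Suc (Suc k)"] by (intro exI[of _ "{0, 1}"] exI) auto
  next
    case (insert z M)
    from insert.IH obtain P\<^sub>1 Q\<^sub>1 I\<^sub>1 where inner: "fan_system (Suc (Suc k)) M P\<^sub>1 Q\<^sub>1 I\<^sub>1"
      "card P\<^sub>1 = num_fans (Suc k) (card M)" "card Q\<^sub>1 + 2 \<le> 2 * card P\<^sub>1" by blast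
    interpret inner: fan_system "Suc (Suc k)" M P\<^sub>1 Q\<^sub>1 I\<^sub>1 by (rule inner(1))
    have "finite P\<^sub>1" using inner.fans_subset inner.finite_blocks by (rule finite_subset)
    \<comment> \<open>The inner fans are the ranks of the outer system; nesting the sizes in this
      way produces growth of Ackermann type.\<close>
    from outer_IH[OF this] obtain P\<^sub>2 Q\<^sub>2 I\<^sub>2 where outer: "fan_system (Suc k) P\<^sub>1 P\<^sub>2 Q\<^sub>2 I\<^sub>2"
      "card P\<^sub>2 = num_fans k (card P\<^sub>1)" "card Q\<^sub>2 + 2 \<le> 2 * card P\<^sub>2" by blast
    obtain w where w: "Q\<^sub>1 \<subseteq> {..<w}"
      using inner.finite_blocks finite_nat_subset_lessThan by blast
    interpret outer: fan_system "Suc k" P\<^sub>1 P\<^sub>2 Q\<^sub>2 I\<^sub>2 by (rule outer(1))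
    interpret fan_composition "Suc k" M P\<^sub>1 Q\<^sub>1 I\<^sub>1 P\<^sub>2 Q\<^sub>2 I\<^sub>2 w z
      by unfold_locales (use w insert.hyps in auto)
    have "card (insert z M) = Suc (card M)"
      using insert.hyps by auto
    then have "card fans = num_fans (Suc k) (card (insert z M))"
      using card_fans inner(2) outer(2) by simp
    moreover have "card blocks + 2 \<le> 2 * card fans"
    proof -
      \<comment> \<open>Over all copies the inner slack adds up to
        \<open>2 * card P\<^sub>2\<close>, which pays for the outer blocks and leaves the required
        2.\<close>
      have "card P\<^sub>2 * (card Q\<^sub>1 + 2) \<le> card P\<^sub>2 * (2 * card P\<^sub>1)"
        using inner(3) by (rule mult_le_mono2)
      then show ?thesis using card_blocks card_fans outer(3) by (simp add: algebra_simps)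
    qed
    ultimately show ?case using composite.fan_system_axioms by blast
  qed
qed

section \<open>Growth of the number of fans\<close>

lemma ack_mono_less: "m < n \<Longrightarrow> ack k m < ack k n"
proof -
  have "ack k n < ack k (Suc n)" for n
    by (cases k) (simp_all add: less_ack)
  then show "m < n \<Longrightarrow> ack k m < ack k n" by (rule lift_Suc_mono_less)
qed

lemma ack_mono_right: "m \<le> n \<Longrightarrow> ack k m \<le> ack k n"
  using ack_mono_less[of m n k] by (cases "m = n") auto

lemma ack_Suc_le: "ack k n \<le> ack (Suc k) n"
proof (cases n)
  case 0
  then show ?thesis by (simp add: ack_mono_right)
next
  case (Suc m)
  have "Suc m \<le> ack (Suc k) m" using less_ack by (rule Suc_leI)
  then show ?thesis using Suc by (simp add: ack_mono_right)
qed

lemma ack_mono_left: "k \<le> l \<Longrightarrow> ack k n \<le> ack l n"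
  using lift_Suc_mono_le[of "\<lambda>k. ack k n"] ack_Suc_le by blast

lemma ack_1: "ack (Suc 0) n = n + 2"
  by (induction n) auto

lemma ack_2: "ack 2 n = 2 * n + 3"
proof -
  have "ack (Suc (Suc 0)) n = 2 * n + 3"
    by (induction n) (simp_all add: ack_1)
  then show ?thesis by (metis numeral_2_eq_2)
qed

text \<open>Level 2 already doubles, and one step at level \<open>k\<close> applies level
  \<open>k - 1\<close>.\<close>

lemma ack_double:
  assumes "3 \<le> k"
  shows "2 * ack k n \<le> ack k (Suc n)"
proof -
  obtain l where l: "k = Suc l" "2 \<le> l" using assms by (cases k) auto
  have "2 * ack k n \<le> ack 2 (ack k n)" by (simp add: ack_2)
  also have "\<dots> \<le> ack l (ack k n)" using l by (intro ack_mono_left)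
  finally show ?thesis using l by simp
qed

lemma ack_power2:
  assumes "3 \<le> k"
  shows "2 ^ j * ack k n \<le> ack k (n + j)"
proof (induction j)
  case (Suc j)
  have "2 ^ Suc j * ack k n \<le> 2 * ack k (n + j)" using Suc by simp
  also have "\<dots> \<le> ack k (n + Suc j)" using ack_double[OF assms, of "n + j"] by simp
  finally show ?case .
qed simp

text \<open>The factor \<open>n\<close> is at most \<open>2 ^ n\<close>, which \<open>n\<close>
  further steps absorb. As \<open>2 * n \<le> ack 2 (n - 1)\<close> for positive \<open>n\<close>,
  the recursion at level \<open>Suc k\<close> takes over.\<close>

lemma times_ack_le:
  assumes "3 \<le> k"
  shows "n * ack k n \<le> ack (Suc k) n"
proof (cases n)
  case (Suc m)
  have "n * ack k n \<le> 2 ^ n * ack k n" by (simp add: less_imp_le)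
  also have "\<dots> \<le> ack k (n + n)" using assms by (rule ack_power2)
  also have "n + n \<le> ack 2 m" using Suc by (simp add: ack_2)
  then have "ack k (n + n) \<le> ack k (ack (Suc k) m)"
    using ack_mono_left[of 2 "Suc k" m] assms by (intro ack_mono_right) simp
  finally show ?thesis using Suc by simp
qed simp

text \<open>The factor \<open>m\<close> matches the recursion, whose right-hand side is
  \<open>N * num_fans k N\<close> for \<open>N = num_fans (Suc k) m\<close>. Each \<open>k\<close>
  costs two levels: one for iterating over \<open>m\<close>, one for absorbing the factor.\<close>

lemma num_fans_le_ack: "m * num_fans k m \<le> ack (2 * k + 2) m"
proof (induction k arbitrary: m)
  case 0
  have "2 * (0::nat) + 2 = 2" by simp
  then show ?case using ack_2[of m] by (simp only: num_fans.simps)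
next
  case (Suc k)
  have "num_fans (Suc k) m \<le> ack (2 * k + 3) m" for m
  proof (induction m)
    case 0
    have "ack 2 0 \<le> ack (2 * k + 3) 0" by (rule ack_mono_left) simp
    then show ?case by (simp add: ack_2)
  next
    case (Suc m)
    have "num_fans (Suc k) (Suc m) \<le> ack (2 * k + 2) (num_fans (Suc k) m)"
      using Suc.prems \<open>\<And>m. m * num_fans k m \<le> ack (2 * k + 2) m\<close> by simp
    also have "\<dots> \<le> ack (2 * k + 2) (ack (2 * k + 3) m)" by (intro ack_mono_right Suc)
    also have "\<dots> = ack (2 * k + 3) (Suc m)" by (simp add: numeral_3_eq_3)
    finally show ?case .
  qed
  then have "m * num_fans (Suc k) m \<le> m * ack (2 * k + 3) m" by (rule mult_le_mono2)
  also have "\<dots> \<le> ack (Suc (2 * k + 3)) m" by (rule times_ack_le) simp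
  finally show ?case by (simp add: eval_nat_numeral)
qed

section \<open>Alternation-free families and edge-ordered graphs\<close>

text \<open>Fans and ranks are forgotten here: they drive the recursion, while the graph relies on
  non-alternation.\<close>

locale alternation_free =
  fixes S Q :: "nat set" and I :: "nat \<Rightarrow> nat set"
  assumes finite_symbols: "finite S"
    and finite_blocks: "finite Q"
    and occ_subset: "a \<in> S \<Longrightarrow> I a \<subseteq> Q"
    and not_alternates: "\<lbrakk>a \<in> S; b \<in> S; a \<noteq> b\<rbrakk> \<Longrightarrow> \<not> alternates (I a) (I b)"

text \<open>The copies occupy disjoint intervals of blocks, so no alternation arises across two of
  them.\<close>

lemma alternation_free_copies:
  assumes "alternation_free S Q I" "\<And>a. a \<in> S \<Longrightarrow> card (I a) = k"
  shows "\<exists>S' Q' I'. alternation_free S' Q' I' \<and> (\<forall>a\<in>S'. card (I' a) = k) \<and>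
    card S' = t * card S \<and> card Q' = t * card Q"
proof -
  interpret alternation_free S Q I by (rule assms(1))
  obtain w where "S \<union> Q \<subseteq> {..<w}"
    using finite_symbols finite_blocks finite_nat_subset_lessThan[of "S \<union> Q"] by auto
  then have S: "S \<subseteq> {..w}" and Q: "Q \<subseteq> {..w}" by auto
  define I' where "I' x = pos w (x div Suc w) ` I (x mod Suc w)" for x
  let ?copies = "\<lambda>A. (\<lambda>(i, a). pos w i a) ` ({..<t} \<times> A)"
  have I': "I' (pos w i a) = pos w i ` I a" if "a \<in> S" for i a
    using that S by (auto simp: I'_def)
  have sub: "I a \<subseteq> {..w}" if "a \<in> S" for a using occ_subset Q that by blast
  have "alternation_free (?copies S) (?copies Q) I'"
  proof
    show "finite (?copies S)" "finite (?copies Q)"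
      using finite_symbols finite_blocks by simp_all
    show "I' x \<subseteq> ?copies Q" if "x \<in> ?copies S" for x
      using that occ_subset by (force simp: I')
    show "\<not> alternates (I' x) (I' y)" if xy: "x \<in> ?copies S" "y \<in> ?copies S" "x \<noteq> y" for x y
    proof
      assume alt: "alternates (I' x) (I' y)"
      from xy obtain i a j b where *: "x = pos w i a" "y = pos w j b" "a \<in> S" "b \<in> S" by auto
      then have "i = j \<and> alternates (I a) (I b)"
        using alt alternates_posD[of w i "I a" j "I b"] sub by (simp add: I')
      then show False using * xy(3) not_alternates by auto
    qed
  qed
  moreover have "\<forall>x\<in>?copies S. card (I' x) = k"
    using assms(2) sub by (auto simp: I' card_image inj_on_pos)
  moreover have "card (?copies A) = t * card A" if "A \<subseteq> {..w}" for A
    using that by (simp add: card_image inj_on_pos_pair card_cartesian_product)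
  ultimately show ?thesis using S Q by blast
qed

text \<open>Restates containment through the inverse \<open>v\<close> of the isomorphism, so that
  edges and their order can be read off from the labels 0 to 6.\<close>

lemma F_star_forest_copy:
  assumes "eo_contains G F_star_forest"
  obtains v :: "nat \<Rightarrow> 'a" where "inj_on v {0..6}"
    and "\<And>i. i \<in> {1..5} \<Longrightarrow> {v (if odd i then 0 else 6), v i} \<in> edges G"
    and "\<And>i j. \<lbrakk>1 \<le> i; i \<le> j; j \<le> 5\<rbrakk> \<Longrightarrow>
      ({v (if odd i then 0 else 6), v i}, {v (if odd j then 0 else 6), v j}) \<in> eorder G"
proof -
  from assms obtain H f where H: "eo_subgraph H G" and f: "eo_isomorphism f H F_star_forest"
    unfolding eo_contains_def eo_isomorphic_def by blast
  have bij: "bij_betw f (verts H) {0..6}"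
    and edges: "(`) f ` edges H = F_edge ` {1..5}"
    and order: "\<And>e e'. \<lbrakk>e \<in> edges H; e' \<in> edges H\<rbrakk> \<Longrightarrow>
      (e, e') \<in> eorder H \<longleftrightarrow> (f ` e, f ` e') \<in> eorder F_star_forest"
    using f by (auto simp: eo_isomorphism_def F_star_forest_def)
  have sub: "\<And>e. e \<in> edges H \<Longrightarrow> e \<subseteq> verts H"
    using H by (auto simp: eo_subgraph_def edge_ordered_graph_def)
  define v where "v = the_inv_into (verts H) f"
  have inj_f: "inj_on f (verts H)" using bij by (simp add: bij_betw_def)
  have "bij_betw v {0..6} (verts H)"
    unfolding v_def using bij by (rule bij_betw_the_inv_into)
  then have inj: "inj_on v {0..6}" by (simp add: bij_betw_def)
  have vf: "v ` f ` e = e" if "e \<in> edges H" for e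
    using sub[OF that] the_inv_into_f_f[OF inj_f] unfolding v_def
    by (force simp: image_iff subset_iff)
  have edge: "v ` F_edge i \<in> edges H \<and> f ` v ` F_edge i = F_edge i" if "i \<in> {1..5}" for i
  proof -
    have "F_edge i \<in> (`) f ` edges H" using edges that by blast
    then obtain e where "e \<in> edges H" "F_edge i = f ` e" by blast
    then show ?thesis using vf by simp
  qed
  have F_edge: "v ` F_edge i = {v (if odd i then 0 else 6), v i}" for i
    by (simp add: F_edge_def)
  show thesis
  proof (rule that[of v])
    show "inj_on v {0..6}" by (rule inj)
    show "{v (if odd i then 0 else 6), v i} \<in> edges G" if "i \<in> {1..5}" for i
      using edge[OF that] H F_edge[of i] by (auto simp: eo_subgraph_def)
    show "({v (if odd i then 0 else 6), v i}, {v (if odd j then 0 else 6), v j}) \<in> eorder G"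
      if "1 \<le> i" "i \<le> j" "j \<le> 5" for i j
    proof -
      have ij: "i \<in> {1..5}" "j \<in> {1..5}" using that by auto
      have "(F_edge i, F_edge j) \<in> eorder F_star_forest"
        using that by (auto simp: F_star_forest_def)
      then have "(v ` F_edge i, v ` F_edge j) \<in> eorder H"
        using order edge[OF ij(1)] edge[OF ij(2)] by simp
      then show ?thesis using H unfolding F_edge by (simp add: eo_subgraph_def)
    qed
  qed
qed

section \<open>The edge-ordered incidence graph\<close>

lemma linear_order_on_key:
  fixes key :: "'a \<Rightarrow> nat"
  assumes "inj_on key A"
  shows "linear_order_on A {(x, y). x \<in> A \<and> y \<in> A \<and> key x \<le> key y}"
  using assms
  by (auto simp: order_on_defs refl_on_def trans_def antisym_def total_on_def inj_on_def)

lemma ex_finite_superset_card: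
  fixes V :: "nat set"
  assumes "finite V" "card V \<le> n"
  shows "\<exists>W. finite W \<and> V \<subseteq> W \<and> card W = n"
proof -
  have "infinite (UNIV - V)" using assms(1) by (simp add: Diff_infinite_finite)
  then obtain U where U: "finite U" "card U = n - card V" "U \<subseteq> UNIV - V"
    using infinite_arbitrarily_large by blast
  then have "card (V \<union> U) = n"
    using assms by (subst card_Un_disjoint) auto
  then show ?thesis using assms U by blast
qed

context alternation_free
begin

text \<open>Symbols become even vertices and blocks odd ones; the edges are ordered by block first.\<close>

definition graph_edge :: "nat \<Rightarrow> nat \<Rightarrow> nat set" where
  "graph_edge a q = {2 * a, Suc (2 * q)}"

definition graph_edges :: "nat set set" where
  "graph_edges = (\<lambda>(a, q). graph_edge a q) ` Sigma S I"

lemma graph_edge_eq_iff: "graph_edge a q = graph_edge a' q' \<longleftrightarrow> a = a' \<and> q = q'"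
  unfolding graph_edge_def doubleton_eq_iff by presburger

lemma card_graph_edges: "card graph_edges = (\<Sum>a\<in>S. card (I a))"
proof -
  have "inj_on (\<lambda>(a, q). graph_edge a q) (Sigma S I)"
    by (auto simp: inj_on_def graph_edge_eq_iff)
  moreover have "\<forall>a\<in>S. finite (I a)"
    using occ_subset finite_blocks finite_subset by blast
  ultimately show ?thesis
    unfolding graph_edges_def using finite_symbols by (simp add: card_image)
qed

text \<open>
  If a star of a copy of the forest is centred at a block, then an edge of the other star lies
  between two of its edges and therefore meets the same block. Hence both centres are symbols,
  and the two symbols alternate.
\<close>

lemma no_star_forest:
  assumes G: "edges G = graph_edges"
    and order: "\<And>a q a' q'. (graph_edge a q, graph_edge a' q') \<in> eorder G \<Longrightarrow> q \<le> q'"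
  shows "\<not> eo_contains G F_star_forest"
proof
  assume "eo_contains G F_star_forest"
  then show False
  proof (rule F_star_forest_copy)
    fix v :: "nat \<Rightarrow> nat"
    assume inj: "inj_on v {0..6}"
      and edge: "\<And>i. i \<in> {1..5} \<Longrightarrow> {v (if odd i then 0 else 6), v i} \<in> edges G"
      and less: "\<And>i j. \<lbrakk>1 \<le> i; i \<le> j; j \<le> 5\<rbrakk> \<Longrightarrow>
        ({v (if odd i then 0 else 6), v i}, {v (if odd j then 0 else 6), v j}) \<in> eorder G"
    define e where "e i = {v (if odd i then 0 else 6), v i}" for i
    have "\<exists>a q. a \<in> S \<and> q \<in> I a \<and> e i = graph_edge a q" if "i \<in> {1..5}" for i
    proof -
      have "e i \<in> graph_edges" unfolding e_def using edge[OF that] G by simp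
      then show ?thesis by (auto simp: graph_edges_def)
    qed
    then obtain a q where aq_e: "\<And>i. i \<in> {1..5} \<Longrightarrow> a i \<in> S \<and> q i \<in> I (a i) \<and>
        e i = graph_edge (a i) (q i)"
      by metis
    note aq = aq_e[unfolded e_def]
    have q_mono: "q i \<le> q j" if "1 \<le> i" "i \<le> j" "j \<le> 5" for i j
      using less[OF that] aq[of i] aq[of j] that order by simp
    have ends: "v c = 2 * a i \<and> v i = Suc (2 * q i) \<or> v c = Suc (2 * q i) \<and> v i = 2 * a i"
      if "i \<in> {1..5}" "c = (if odd i then 0 else 6)" for i c
      using aq[OF that(1)] that(2) by (auto simp: graph_edge_def doubleton_eq_iff)
    have block: "\<exists>j\<in>{c, i}. v j = Suc (2 * q i)"
      if "i \<in> {1..5}" "c = (if odd i then 0 else 6)" for i c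
      using ends[OF that] by auto
    have centre: "v c = Suc (2 * q i)"
      if "i \<in> {1..5}" "c = (if odd i then 0 else 6)" "odd (v c)" for i c
      using ends[OF that(1,2)] that(3) by auto
    have v_eq: "v i = v j \<longleftrightarrow> i = j" if "i \<le> 6" "j \<le> 6" for i j
      using inj that by (auto simp: inj_on_def)
    show False
    proof (cases "odd (v 0)")
      case True
      then have "v 0 = Suc (2 * q 1)" "v 0 = Suc (2 * q 3)"
        using centre[of 1 0] centre[of 3 0] by simp_all
      moreover from this have "q 2 = q 1" using q_mono[of 1 2] q_mono[of 2 3] by simp
      ultimately show False using block[of 2 6] v_eq[of 0 2] v_eq[of 0 6] by auto
    next
      case v0: False
      show False
      proof (cases "odd (v 6)")
        case True
        then have "v 6 = Suc (2 * q 2)" "v 6 = Suc (2 * q 4)"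
          using centre[of 2 6] centre[of 4 6] by simp_all
        moreover from this have "q 3 = q 2" using q_mono[of 2 3] q_mono[of 3 4] by simp
        ultimately show False using block[of 3 0] v_eq[of 6 3] v_eq[of 6 0] by auto
      next
        case v6: False
        have odd: "v 0 = 2 * a i \<and> v i = Suc (2 * q i)" if "i \<in> {1, 3, 5}" for i
          using ends[of i 0] v0 that by auto
        have even: "v 6 = 2 * a i \<and> v i = Suc (2 * q i)" if "i \<in> {2, 4}" for i
          using ends[of i 6] v6 that by auto
        have a: "a 3 = a 1" "a 5 = a 1" "a 4 = a 2"
          using odd[of 1] odd[of 3] odd[of 5] even[of 2] even[of 4] by auto
        have "a 1 \<noteq> a 2" using odd[of 1] even[of 2] v_eq[of 0 6] by auto
        \<comment> \<open>With both centres symbols, all leaves are blocks. Distinct leaves make the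
          weak order of the blocks strict.\<close>
        moreover have "q i < q (Suc i)" if "i \<in> {1..4}" for i
        proof -
          have "i \<in> {1, 3, 5} \<or> i \<in> {2, 4}" "Suc i \<in> {1, 3, 5} \<or> Suc i \<in> {2, 4}"
            using that by auto
          then have "v i = Suc (2 * q i)" "v (Suc i) = Suc (2 * q (Suc i))"
            using odd even by blast+
          moreover have "v i \<noteq> v (Suc i)" using v_eq[of i "Suc i"] that by auto
          moreover have "q i \<le> q (Suc i)" using q_mono[of i "Suc i"] that by auto
          ultimately show ?thesis by auto
        qed
        from this[of 1] this[of 2] this[of 3] this[of 4]
        have "q 1 < q 2" "q 2 < q 3" "q 3 < q 4" "q 4 < q 5" by (simp_all add: eval_nat_numeral)
        then have "alternates (I (a 1)) (I (a 2))"
          using aq[of 1] aq[of 2] aq[of 3] aq[of 4] aq[of 5] a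
          by (intro alternatesI[of "q 1" _ "q 2" _ "q 3" "q 4" "q 5"]) simp_all
        ultimately show False using not_alternates aq[of 1] aq[of 2] by auto
      qed
    qed
  qed
qed

lemma ex_eo_ge:
  assumes n: "card S + card Q \<le> n"
  shows "(\<Sum>a\<in>S. card (I a)) \<le> ex_eo n F_star_forest"
proof -
  obtain w where w: "S \<subseteq> {..<w}" using finite_symbols finite_nat_subset_lessThan by blast
  \<comment> \<open>An edge has exactly one odd and one even element, which \<open>Max\<close>
    merely extracts. The block is the major coordinate and the symbol breaks ties.\<close>
  define key where "key e = pos w (Max (Collect odd \<inter> e) div 2) (Max (Collect even \<inter> e) div 2)" for e
  have key: "key (graph_edge a q) = pos w q a" for a q
  proof -
    have "Collect odd \<inter> graph_edge a q = {Suc (2 * q)}" "Collect even \<inter> graph_edge a q = {2 * a}"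
      by (auto simp: graph_edge_def)
    then show ?thesis by (simp add: key_def)
  qed
  have inj_key: "inj_on key graph_edges"
    using w by (auto simp: inj_on_def graph_edges_def key pos_eq_iff subset_iff less_imp_le)
  let ?V = "(\<lambda>a. 2 * a) ` S \<union> (\<lambda>q. Suc (2 * q)) ` Q"
  have "card ?V \<le> card S + card Q"
    by (intro order_trans[OF card_Un_le] add_mono card_image_le finite_symbols finite_blocks)
  \<comment> \<open>Isolated vertices bring the number of vertices to exactly
    \<open>n\<close>.\<close>
  then obtain V where V: "finite V" "?V \<subseteq> V" "card V = n"
    using ex_finite_superset_card[of ?V n] n finite_symbols finite_blocks by auto
  define G where "G = \<lparr>verts = V, edges = graph_edges,
    eorder = {(e, e'). e \<in> graph_edges \<and> e' \<in> graph_edges \<and> key e \<le> key e'}\<rparr>"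
  have "e \<subseteq> V \<and> card e = 2" if "e \<in> graph_edges" for e
  proof -
    from that obtain a q where e: "e = graph_edge a q" "a \<in> S" "q \<in> I a"
      unfolding graph_edges_def by auto
    have "2 * a \<noteq> Suc (2 * q)" by presburger
    moreover have "2 * a \<in> V" "Suc (2 * q) \<in> V" using e V(2) occ_subset by blast+
    ultimately show ?thesis using e by (auto simp: graph_edge_def)
  qed
  then have "edge_ordered_graph G"
    using V linear_order_on_key[OF inj_key] by (auto simp: edge_ordered_graph_def G_def)
  moreover have "\<not> eo_contains G F_star_forest"
  proof (rule no_star_forest)
    fix a q a' q' assume "(graph_edge a q, graph_edge a' q') \<in> eorder G"
    then have "a \<in> S" "a' \<in> S" "pos w q a \<le> pos w q' a'"
      by (auto simp: G_def graph_edges_def graph_edge_eq_iff key)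
    then show "q \<le> q'" using w by (auto simp: pos_le_iff subset_iff less_imp_le)
  qed (simp add: G_def)
  ultimately have "card (edges G) \<in> ex_eo_sizes n F_star_forest"
    using V(3) unfolding ex_eo_sizes_def by (intro CollectI exI[of _ G]) (simp add: G_def)
  then show ?thesis
    unfolding ex_eo_def using Max_ge[OF finite_ex_eo_sizes]
    by (simp add: G_def card_graph_edges)
qed

end

section \<open>The lower bound\<close>

lemma ex_eo_lower_bound:
  assumes n: "3 * num_fans k 1 \<le> n"
  shows "Suc k * n \<le> 6 * ex_eo n F_star_forest"
proof -
  obtain P Q I where sys: "fan_system (Suc k) {0} P Q I" "card P = num_fans k 1"
    "card Q + 2 \<le> 2 * card P"
    using ex_fan_system[of "{0}" k] by auto
  interpret fan_system "Suc k" "{0}" P Q I by (rule sys(1))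
  have "alternation_free P Q (\<lambda>p. I p 0)"
    using finite_blocks fans_subset occ_subset not_alternates
    by unfold_locales (auto intro: finite_subset)
  \<comment> \<open>With the single rank 0 there are \<open>card P\<close> symbols and fewer than
    \<open>2 * card P\<close> blocks, so one copy needs at most \<open>d\<close> vertices.\<close>
  moreover define d where "d = 3 * card P"
  define t where "t = n div d"
  ultimately obtain S' Q' I' where copies: "alternation_free S' Q' I'"
    "\<forall>a\<in>S'. card (I' a) = Suc k" "card S' = t * card P" "card Q' = t * card Q"
    using alternation_free_copies[of P Q "\<lambda>p. I p 0" "Suc k" t] card_occ by auto
  interpret copies: alternation_free S' Q' I' by (rule copies(1))
  have "0 < d" "d \<le> n" using sys n by (auto simp: d_def)
  then have "0 < t" by (simp add: t_def div_greater_zero_iff)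
  have "card S' + card Q' = t * (card P + card Q)" using copies by (simp add: algebra_simps)
  also have "\<dots> \<le> t * d" using sys by (intro mult_le_mono2) (simp add: d_def)
  also have "\<dots> \<le> n" by (simp add: t_def)
  finally have "(\<Sum>a\<in>S'. card (I' a)) \<le> ex_eo n F_star_forest" by (rule copies.ex_eo_ge)
  then have edges: "t * card P * Suc k \<le> ex_eo n F_star_forest" using copies by simp
  \<comment> \<open>As \<open>t\<close> is positive, rounding \<open>n\<close> down to a multiple of
    \<open>d\<close> loses at most a factor 2; with \<open>d = 3 * card P\<close> this gives the
    constant 6.\<close>
  have "n < t * d + d"
    using \<open>0 < d\<close> div_mult_mod_eq[of n d] mod_less_divisor[of d n] unfolding t_def by linarith
  also have "\<dots> \<le> 2 * (t * d)" using \<open>0 < t\<close> by simp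
  finally have "n \<le> 6 * (t * card P)" by (simp add: d_def)
  then have "Suc k * n \<le> Suc k * (6 * (t * card P))" by (rule mult_le_mono2)
  also have "\<dots> = 6 * (t * card P * Suc k)" by simp
  also have "\<dots> \<le> 6 * ex_eo n F_star_forest" using edges by (rule mult_le_mono2)
  finally show ?thesis .
qed

section \<open>Comparison with the inverse Ackermann function\<close>

lemma inv_ack_greater: "ack k k < n \<Longrightarrow> k < inv_ack n"
proof (rule ccontr)
  assume "ack k k < n" "\<not> k < inv_ack n"
  then have "inv_ack n \<le> k" by simp
  then have "ack (inv_ack n) (inv_ack n) \<le> ack k k"
    using ack_mono_left ack_mono_right by (meson le_trans)
  then show False using inv_ack_le[of n] \<open>ack k k < n\<close> by simp
qed

lemma ack_less_of_less_inv_ack: "k < inv_ack n \<Longrightarrow> ack k k < n"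
  unfolding inv_ack_def by (meson not_less_Least not_le_imp_less)

lemma ex_eo_ge_inv_ack:
  assumes "ack 4 4 < n"
  shows "n * inv_ack n \<le> 24 * ex_eo n F_star_forest"
proof -
  define a where "a = inv_ack n"
  have a: "5 \<le> a" using inv_ack_greater[OF assms] by (simp add: a_def)
  \<comment> \<open>This is the largest \<open>k\<close> whose level \<open>2 * k + 2\<close> stays
    below \<open>a\<close>. For \<open>a \<ge> 5\<close> it is positive and satisfies
    \<open>a \<le> 4 * Suc k\<close>, whence the constant 24 = 6 * 4.\<close>
  define k where "k = (a - 1) div 2 - 1"
  have k: "2 * k + 2 \<le> a - 1" "a \<le> 4 * Suc k" "1 \<le> k" using a by (auto simp: k_def)
  have "3 * num_fans k 1 \<le> 3 * ack (2 * k + 2) 1"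
    using num_fans_le_ack[of 1 k] by simp
  \<comment> \<open>Rounding 3 up to a power of two lets two extra steps in the second argument
    absorb it.\<close>
  also have "\<dots> \<le> 2 ^ 2 * ack (2 * k + 2) 1" by simp
  also have "\<dots> \<le> ack (2 * k + 2) (1 + 2)" using k by (intro ack_power2) simp
  also have "\<dots> \<le> ack (a - 1) (1 + 2)" using k by (intro ack_mono_left)
  also have "\<dots> \<le> ack (a - 1) (a - 1)" using a by (intro ack_mono_right) simp
  also have "\<dots> < n" using a by (intro ack_less_of_less_inv_ack) (simp add: a_def)
  finally have "Suc k * n \<le> 6 * ex_eo n F_star_forest" by (intro ex_eo_lower_bound) simp
  moreover have "n * a \<le> n * (4 * Suc k)" using k by (intro mult_le_mono2)
  ultimately show ?thesis by (simp add: a_def algebra_simps)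
qed

theorem theorem3p5:
  shows "(\<lambda>n. real (ex_eo n F_star_forest)) \<in> \<Omega>(\<lambda>n. real n * real (inv_ack n))"
proof (rule landau_omega.bigI)
  show "\<forall>\<^sub>F n in sequentially. norm (real (ex_eo n F_star_forest)) \<ge>
      1 / 24 * norm (real n * real (inv_ack n))"
    using eventually_gt_at_top[of "ack 4 4"]
  proof eventually_elim
    case (elim n)
    then have "real (n * inv_ack n) \<le> real (24 * ex_eo n F_star_forest)"
      by (intro of_nat_mono ex_eo_ge_inv_ack)
    then show ?case by simp
  qed
qed simp

end
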